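(* Let $(A,\mu,\alpha)$ be a multiplicative right Hom-alternative algebra over a field $\mathbf{k}$ of characteristic $0$. Then the following identities hold for all $w,x,y,z\in A$: \begin{align*} &\text{(a)}\quad as(\alpha(x),\alpha(y),yz)=as(x,y,z)\,\alpha^2(y);\\ &\text{(b)}\quad as(\alpha(x),\alpha(w),yz)+as(\alpha(x),\alpha(y),wz)=as(x,w,z)\,\alpha^2(y)+as(x,y,z)\,\alpha^2(w);\\ &\text{(c)}\quad as(wx,\alpha(y),\alpha(z))+as(\alpha(w),\alpha(x),[y,z])=\alpha^2(w)\,as(x,y,z)+as(w,y,z)\,\alpha^2(x);\\ &\text{(d)}\quad as(\alpha(x),y^2,\alpha(z))=as(\alpha(x),\alpha(y),yz+zy);\\ &\text{(e)}\quad ((xy)\alpha(z))\,\alpha^2(y)=\alpha^2(x)\,((yz)\alpha(y));\\ &\text{(f)}\quad (as(x,y,z)\,\alpha^2(y))\,\alpha^3(z)=\alpha\bigl(as(x,y,z)\,\alpha(zy)\bigr). \end{align*}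
   Context: We work over a fixed field $\mathbf{k}$ of characteristic $0$. A Hom-algebra is a triple $(A,\mu,\alpha)$ where $A$ is a $\mathbf{k}$-module, $\mu\colon A^{\otimes 2}\to A$ is bilinear (written $xy=\mu(x,y)$), and $\alpha\colon A\to A$ is linear. It is multiplicative if $\alpha(xy)=\alpha(x)\alpha(y)$ for all $x,y\in A$. The Hom-associator is $as(x,y,z)=as_A(x,y,z)=(xy)\alpha(z)-\alpha(x)(yz)$. $A$ is right Hom-alternative if $as(x,y,y)=0$ for all $x,y\in A$. Here $[y,z]=yz-zy$, $y^2=yy$, and $\alpha^n$ is the $n$-fold composition of $\alpha$. *)

theory Defs
  imports Complex_Main
begin

text \<open>
  A bilinear map on a vector space is the same thing as a linear map on its tensor square;
  the multiplication of a Hom-algebra is given in the former way.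
\<close>

locale hom_algebra = vector_space scale
  for scale :: "'k::field \<Rightarrow> 'a::ab_group_add \<Rightarrow> 'a" +
  fixes mult :: "'a \<Rightarrow> 'a \<Rightarrow> 'a" (infixl "\<cdot>" 70)
    and twist :: "'a \<Rightarrow> 'a" ("\<alpha>")
  assumes linear_mult_left: "Vector_Spaces.linear scale scale (\<lambda>x. x \<cdot> y)"
    and linear_mult_right: "Vector_Spaces.linear scale scale (\<lambda>y. x \<cdot> y)"
    and linear_twist: "Vector_Spaces.linear scale scale \<alpha>"

definition hom_associator ::
    "('a::ab_group_add \<Rightarrow> 'a \<Rightarrow> 'a) \<Rightarrow> ('a \<Rightarrow> 'a) \<Rightarrow> 'a \<Rightarrow> 'a \<Rightarrow> 'a \<Rightarrow> 'a" where
  "hom_associator mult \<alpha> x y z = mult (mult x y) (\<alpha> z) - mult (\<alpha> x) (mult y z)"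

definition commutator :: "('a::ab_group_add \<Rightarrow> 'a \<Rightarrow> 'a) \<Rightarrow> 'a \<Rightarrow> 'a \<Rightarrow> 'a" where
  "commutator mult y z = mult y z - mult z y"

locale multiplicative_hom_algebra = hom_algebra +
  assumes twist_mult: "\<alpha> (x \<cdot> y) = \<alpha> x \<cdot> \<alpha> y"

locale right_hom_alternative_algebra = hom_algebra +
  assumes right_hom_alternative: "hom_associator (\<cdot>) \<alpha> x y y = 0"

end

theory Submission
  imports Defs
begin

text \<open>
  Everything follows from two facts. The first is the Hom-Teichmueller identity, a five-term
  relation between associators of four elements that holds in every multiplicative
  Hom-algebra because it is a telescoping sum. The second is that right Hom-alternativity, by
  polarization, makes the associator skew in its last two arguments.

  Adding the Teichmueller identities for \<open>(x, y, y, z)\<close> and \<open>(x, y, z, y)\<close> and comparing with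
  the one for \<open>(x, z, y, y)\<close> gives twice identity (a), and the factor \<open>2\<close> is cancelled in
  characteristic \<open>0\<close>. The identity for \<open>(x, z, y, y)\<close> also expresses \<open>as(\<alpha>(x), y\<^sup>2, \<alpha>(z))\<close>
  as the sum of \<open>as(\<alpha>(x), \<alpha>(y), zy)\<close> and the right-hand side of (a), which is (d).
  Identity (b) is the linearization of (a), and (c) is the Teichmueller identity with two
  of its terms rewritten by (b). Identity (e), the right Hom-Moufang identity, says that
  (a) and skew-symmetry move both factors across a triple product.

  Identity (f) is the deepest one. Two applications of (b), together with (d) and (a), reduce it
  to the skew-symmetry of \<open>as(\<alpha>\<^sup>2(x), \<alpha>\<^sup>2(y), (zy)\<alpha>(z))\<close> in \<open>y\<close> and \<open>z\<close>
  (lemma \<open>assoc_triple_product_skew\<close>). Without the twist, that skewness reads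
  \<open>(x,y,zyz) + (x,z,yzy) = 0\<close>; it holds because \<open>z(yzy) = (zyz)y\<close>, so that right
  multiplication by \<open>y(zyz) + z(yzy)\<close> is the Jordan product of the right multiplications
  by \<open>y\<close> and \<open>zyz\<close>.
\<close>

section \<open>The associator of a multiplicative Hom-algebra\<close>

context hom_algebra
begin

abbreviation assoc :: "'a \<Rightarrow> 'a \<Rightarrow> 'a \<Rightarrow> 'a"
  where "assoc \<equiv> hom_associator (\<cdot>) \<alpha>"

lemma mult_add_left: "(x + x') \<cdot> y = x \<cdot> y + x' \<cdot> y"
  using linear_mult_left[of y] by (simp add: Vector_Spaces.linear_iff)

lemma mult_add_right: "x \<cdot> (y + y') = x \<cdot> y + x \<cdot> y'"
  using linear_mult_right[of x] by (simp add: Vector_Spaces.linear_iff)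

lemma twist_add: "\<alpha> (x + y) = \<alpha> x + \<alpha> y"
  using linear_twist by (simp add: Vector_Spaces.linear_iff)

lemma mult_diff_left: "(x - x') \<cdot> y = x \<cdot> y - x' \<cdot> y"
  using mult_add_left[of "x - x'" x' y] by (simp add: algebra_simps)

lemma mult_diff_right: "x \<cdot> (y - y') = x \<cdot> y - x \<cdot> y'"
  using mult_add_right[of x "y - y'" y'] by (simp add: algebra_simps)

lemma mult_zero_right: "x \<cdot> 0 = 0"
  using mult_diff_right[of x 0 0] by simp

lemma mult_zero_left: "0 \<cdot> x = 0"
  using mult_diff_left[of 0 0 x] by simp

lemma mult_minus_left: "(- x) \<cdot> y = - (x \<cdot> y)"
  using mult_diff_left[of 0 x y] by (simp add: mult_zero_left)

lemma twist_diff: "\<alpha> (x - y) = \<alpha> x - \<alpha> y"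
  using twist_add[of "x - y" y] by (simp add: algebra_simps)

lemma assoc_add_middle: "assoc x (y + y') z = assoc x y z + assoc x y' z"
  by (simp add: hom_associator_def mult_add_left mult_add_right algebra_simps)

lemma assoc_add_right: "assoc x y (z + z') = assoc x y z + assoc x y z'"
  by (simp add: hom_associator_def mult_add_right twist_add algebra_simps)

lemma assoc_diff_right: "assoc x y (z - z') = assoc x y z - assoc x y z'"
  by (simp add: hom_associator_def mult_diff_right twist_diff algebra_simps)

end

context multiplicative_hom_algebra
begin

lemma twist_assoc: "\<alpha> (assoc x y z) = assoc (\<alpha> x) (\<alpha> y) (\<alpha> z)"
  by (simp add: hom_associator_def twist_mult twist_diff)

text \<open>
  Each of the five ways to bracket four factors occurs twice, with opposite signs. Multiplicativity
  is what makes \<open>\<alpha>(w) \<alpha>(x)\<close> and \<open>\<alpha>(wx)\<close>, which arise from different terms, cancel.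
\<close>
lemma hom_teichmueller:
  "assoc (w \<cdot> x) (\<alpha> y) (\<alpha> z) - assoc (\<alpha> w) (x \<cdot> y) (\<alpha> z) + assoc (\<alpha> w) (\<alpha> x) (y \<cdot> z)
    = \<alpha> (\<alpha> w) \<cdot> assoc x y z + assoc w x y \<cdot> \<alpha> (\<alpha> z)"
  by (simp add: hom_associator_def twist_mult mult_diff_left mult_diff_right)

end

section \<open>Identities of right Hom-alternative algebras\<close>

locale multiplicative_right_hom_alternative_algebra =
  multiplicative_hom_algebra scale mult twist + right_hom_alternative_algebra scale mult twist
  for scale :: "'k::field_char_0 \<Rightarrow> 'a::ab_group_add \<Rightarrow> 'a"
    and mult :: "'a \<Rightarrow> 'a \<Rightarrow> 'a" (infixl "\<cdot>" 70)
    and twist :: "'a \<Rightarrow> 'a" ("\<alpha>")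
begin

lemma double_cancel:
  fixes a b :: 'a
  assumes "a + a = b + b"
  shows "a = b"
proof -
  have "scale 2 c = c + c" for c
    using scale_left_distrib[of 1 1 c] by simp
  then have "scale 2 a = scale 2 b"
    using assms by simp
  then show ?thesis
    by simp
qed

lemma assoc_skew: "assoc x z y = - assoc x y z"
proof -
  have "assoc x (y + z) (y + z) = 0"
    by (rule right_hom_alternative)
  then have "assoc x z y + assoc x y z = 0"
    unfolding assoc_add_middle assoc_add_right by (simp add: right_hom_alternative add.commute)
  then show ?thesis
    by (simp add: eq_neg_iff_add_eq_0)
qed

text \<open>
  The Teichmueller identity for \<open>(x, z, y, y)\<close>: right Hom-alternativity kills two of its terms.
\<close>
lemma assoc_square_middle_expand:
  "assoc (\<alpha> x) (y \<cdot> y) (\<alpha> z) = assoc (\<alpha> x) (\<alpha> y) (z \<cdot> y) + assoc x y z \<cdot> \<alpha> (\<alpha> y)"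
proof -
  have "- assoc (\<alpha> x) (z \<cdot> y) (\<alpha> y) + assoc (\<alpha> x) (\<alpha> z) (y \<cdot> y) = assoc x z y \<cdot> \<alpha> (\<alpha> y)"
    using hom_teichmueller[of x z y y] by (simp add: right_hom_alternative mult_zero_right)
  then show ?thesis
    using assoc_skew[of "\<alpha> x" "z \<cdot> y" "\<alpha> y"] assoc_skew[of "\<alpha> x" "y \<cdot> y" "\<alpha> z"]
      assoc_skew[of x y z]
    by (simp add: mult_minus_left algebra_simps)
qed

text \<open>
  In the sum of the Teichmueller identities for \<open>(x, y, y, z)\<close> and \<open>(x, y, z, y)\<close>
  the terms that contain a product in the first argument, and those multiplied from the left, cancel
  by skewness. What remains contains the wanted associator twice.
\<close>
lemma assoc_mult_right:
  "assoc (\<alpha> x) (\<alpha> y) (y \<cdot> z) = assoc x y z \<cdot> \<alpha> (\<alpha> y)"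
proof (rule double_cancel)
  have 1: "assoc (x \<cdot> y) (\<alpha> y) (\<alpha> z) - assoc (\<alpha> x) (y \<cdot> y) (\<alpha> z) + assoc (\<alpha> x) (\<alpha> y) (y \<cdot> z)
      = \<alpha> (\<alpha> x) \<cdot> assoc y y z"
    using hom_teichmueller[of x y y z] by (simp add: right_hom_alternative mult_zero_left)
  have 2: "- assoc (x \<cdot> y) (\<alpha> y) (\<alpha> z) + assoc (\<alpha> x) (\<alpha> y) (y \<cdot> z) + assoc (\<alpha> x) (\<alpha> y) (z \<cdot> y)
      = - (\<alpha> (\<alpha> x) \<cdot> assoc y y z) + assoc x y z \<cdot> \<alpha> (\<alpha> y)"
    using hom_teichmueller[of x y z y] assoc_skew[of "x \<cdot> y" "\<alpha> z" "\<alpha> y"]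
      assoc_skew[of "\<alpha> x" "y \<cdot> z" "\<alpha> y"] assoc_skew[of y z y]
      mult_diff_right[of "\<alpha> (\<alpha> x)" 0 "assoc y y z"]
    by (simp add: mult_zero_right)
  have "assoc (\<alpha> x) (\<alpha> y) (y \<cdot> z) + assoc (\<alpha> x) (\<alpha> y) (y \<cdot> z)
      = (assoc (x \<cdot> y) (\<alpha> y) (\<alpha> z) - assoc (\<alpha> x) (y \<cdot> y) (\<alpha> z) + assoc (\<alpha> x) (\<alpha> y) (y \<cdot> z))
       + (- assoc (x \<cdot> y) (\<alpha> y) (\<alpha> z) + assoc (\<alpha> x) (\<alpha> y) (y \<cdot> z)
           + assoc (\<alpha> x) (\<alpha> y) (z \<cdot> y))
       + (assoc (\<alpha> x) (y \<cdot> y) (\<alpha> z) - assoc (\<alpha> x) (\<alpha> y) (z \<cdot> y))"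
    by (simp add: algebra_simps)
  also have "\<dots> = assoc x y z \<cdot> \<alpha> (\<alpha> y) + assoc x y z \<cdot> \<alpha> (\<alpha> y)"
    unfolding 1 2 by (simp add: assoc_square_middle_expand algebra_simps)
  finally show "assoc (\<alpha> x) (\<alpha> y) (y \<cdot> z) + assoc (\<alpha> x) (\<alpha> y) (y \<cdot> z)
      = assoc x y z \<cdot> \<alpha> (\<alpha> y) + assoc x y z \<cdot> \<alpha> (\<alpha> y)" .
qed

lemma assoc_mult_right_linearized:
  "assoc (\<alpha> x) (\<alpha> w) (y \<cdot> z) + assoc (\<alpha> x) (\<alpha> y) (w \<cdot> z)
    = assoc x w z \<cdot> \<alpha> (\<alpha> y) + assoc x y z \<cdot> \<alpha> (\<alpha> w)"
  using assoc_mult_right[of x "w + y" z] assoc_mult_right[of x w z] assoc_mult_right[of x y z]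
  by (simp add: twist_add mult_add_left mult_add_right assoc_add_middle assoc_add_right add.commute)

text \<open>
  After skewness, (c) differs from the Teichmueller identity exactly by the
  linearized form of (a) in which \<open>x\<close> and \<open>z\<close> are polarized against the fixed factor \<open>y\<close>.
\<close>
lemma assoc_mult_left:
  "assoc (w \<cdot> x) (\<alpha> y) (\<alpha> z) + assoc (\<alpha> w) (\<alpha> x) (commutator (\<cdot>) y z)
    = \<alpha> (\<alpha> w) \<cdot> assoc x y z + assoc w y z \<cdot> \<alpha> (\<alpha> x)"
proof -
  have 1: "assoc (\<alpha> w) (\<alpha> z) (x \<cdot> y) + assoc (\<alpha> w) (\<alpha> x) (z \<cdot> y)
      = assoc w x y \<cdot> \<alpha> (\<alpha> z) - assoc w y z \<cdot> \<alpha> (\<alpha> x)"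
    using assoc_mult_right_linearized[of w z x y] assoc_skew[of w z y]
    by (simp add: mult_minus_left)
  have "assoc (w \<cdot> x) (\<alpha> y) (\<alpha> z) + assoc (\<alpha> w) (\<alpha> x) (commutator (\<cdot>) y z)
      = (assoc (w \<cdot> x) (\<alpha> y) (\<alpha> z) - assoc (\<alpha> w) (x \<cdot> y) (\<alpha> z) + assoc (\<alpha> w) (\<alpha> x) (y \<cdot> z))
        - (assoc (\<alpha> w) (\<alpha> z) (x \<cdot> y) + assoc (\<alpha> w) (\<alpha> x) (z \<cdot> y))"
    using assoc_skew[of "\<alpha> w" "x \<cdot> y" "\<alpha> z"]
    by (simp add: commutator_def assoc_diff_right)
  then show ?thesis
    unfolding 1 hom_teichmueller by simp
qed

lemma assoc_square_middle:
  "assoc (\<alpha> x) (y \<cdot> y) (\<alpha> z) = assoc (\<alpha> x) (\<alpha> y) (y \<cdot> z + z \<cdot> y)"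
  using assoc_square_middle_expand[of x y z] assoc_mult_right[of x y z]
  by (simp add: assoc_add_right add.commute)

lemma right_hom_moufang:
  "((x \<cdot> y) \<cdot> \<alpha> z) \<cdot> \<alpha> (\<alpha> y) = \<alpha> (\<alpha> x) \<cdot> ((y \<cdot> z) \<cdot> \<alpha> y)"
proof -
  have "((x \<cdot> y) \<cdot> \<alpha> z) \<cdot> \<alpha> (\<alpha> y) = assoc x y z \<cdot> \<alpha> (\<alpha> y) + (\<alpha> x \<cdot> (y \<cdot> z)) \<cdot> \<alpha> (\<alpha> y)"
    by (simp add: hom_associator_def mult_diff_left)
  also have "(\<alpha> x \<cdot> (y \<cdot> z)) \<cdot> \<alpha> (\<alpha> y)
      = assoc (\<alpha> x) (y \<cdot> z) (\<alpha> y) + \<alpha> (\<alpha> x) \<cdot> ((y \<cdot> z) \<cdot> \<alpha> y)"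
    by (simp add: hom_associator_def)
  finally show ?thesis
    using assoc_skew[of "\<alpha> x" "y \<cdot> z" "\<alpha> y"] assoc_mult_right[of x y z] by simp
qed

section \<open>Associators with a triple product\<close>

text \<open>
  Write \<open>v = (zy)\<alpha>(z)\<close>. By the Moufang identity the product \<open>\<alpha>\<^sup>2(z)((yz)\<alpha>(y))\<close>
  inside the second associator is \<open>v \<alpha>\<^sup>2(y)\<close>, the opposite of the product
  \<open>\<alpha>\<^sup>2(y) v\<close> inside the first. Skewness exchanges \<open>v \<alpha>\<^sup>2(y)\<close> for \<open>\<alpha>\<^sup>2(y) v\<close>, and the Moufang
  identity, used twice more, matches the terms that are bracketed to the left.
\<close>
lemma assoc_triple_product_skew:
  "assoc (\<alpha> (\<alpha> x)) (\<alpha> (\<alpha> y)) ((z \<cdot> y) \<cdot> \<alpha> z) = - assoc (\<alpha> (\<alpha> x)) (\<alpha> (\<alpha> z)) ((y \<cdot> z) \<cdot> \<alpha> y)"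
proof -
  let ?X = "\<alpha> (\<alpha> x)" and ?Y = "\<alpha> (\<alpha> y)" and ?Z = "\<alpha> (\<alpha> z)"
  let ?v = "(z \<cdot> y) \<cdot> \<alpha> z"
  have "assoc ?X ?Y ?v = - assoc ?X ?v ?Y"
    by (rule assoc_skew)
  also have "\<dots> = \<alpha> ?X \<cdot> (?v \<cdot> ?Y) - (?X \<cdot> ?v) \<cdot> \<alpha> ?Y"
    by (simp add: hom_associator_def)
  also have "?v \<cdot> ?Y = ?Z \<cdot> ((y \<cdot> z) \<cdot> \<alpha> y)"
    by (rule right_hom_moufang)
  also have "?X \<cdot> ?v = ((x \<cdot> z) \<cdot> \<alpha> y) \<cdot> ?Z"
    by (rule right_hom_moufang[symmetric])
  also have "(((x \<cdot> z) \<cdot> \<alpha> y) \<cdot> ?Z) \<cdot> \<alpha> ?Y = (?X \<cdot> ?Z) \<cdot> \<alpha> ((y \<cdot> z) \<cdot> \<alpha> y)"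
    using right_hom_moufang[of "x \<cdot> z" "\<alpha> y" "\<alpha> z"] by (simp add: twist_mult)
  finally show ?thesis
    by (simp add: hom_associator_def)
qed

text \<open>
  With \<open>u = yz + zy\<close>, the claim is equivalent to an expression for
  \<open>as(\<alpha>(x),\<alpha>(y),\<alpha>(z)) \<alpha>\<^sup>2(u)\<close>, because (b) trades the left-hand side for
  \<open>- as(\<alpha>(x),\<alpha>(y),\<alpha>(z)) \<alpha>\<^sup>2(yz)\<close> plus associators. A second use of (b) computes that product, up to
  \<open>as(\<alpha>(x),u,\<alpha>(z)) \<alpha>\<^sup>3(y)\<close>, which (d) and (a) turn into a single associator.
\<close>
lemma assoc_mult_mult:
  "(assoc x y z \<cdot> \<alpha> (\<alpha> y)) \<cdot> \<alpha> (\<alpha> (\<alpha> z)) = \<alpha> (assoc x y z \<cdot> \<alpha> (z \<cdot> y))"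
proof -
  let ?X = "\<alpha> (\<alpha> x)" and ?Y = "\<alpha> (\<alpha> y)" and ?Z = "\<alpha> (\<alpha> z)"
  let ?u = "y \<cdot> z + z \<cdot> y"
  let ?a = "assoc (\<alpha> x) (\<alpha> y) (\<alpha> z)"
  have first: "(assoc x y z \<cdot> ?Y) \<cdot> \<alpha> ?Z
      = - (?a \<cdot> \<alpha> (\<alpha> (y \<cdot> z)))
        - assoc ?X (\<alpha> (y \<cdot> z)) (\<alpha> (z \<cdot> y)) - assoc ?X ?Z ((y \<cdot> z) \<cdot> \<alpha> y)"
  proof -
    have "(assoc x y z \<cdot> ?Y) \<cdot> \<alpha> ?Z = - (assoc (\<alpha> x) (y \<cdot> z) (\<alpha> y) \<cdot> \<alpha> ?Z)"
      using assoc_skew[of "\<alpha> x" "y \<cdot> z" "\<alpha> y"]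
      by (simp add: assoc_mult_right mult_minus_left)
    moreover have "assoc ?X (\<alpha> (y \<cdot> z)) (\<alpha> (z \<cdot> y)) + assoc ?X ?Z ((y \<cdot> z) \<cdot> \<alpha> y)
        = assoc (\<alpha> x) (y \<cdot> z) (\<alpha> y) \<cdot> \<alpha> ?Z - ?a \<cdot> \<alpha> (\<alpha> (y \<cdot> z))"
      using assoc_mult_right_linearized[of "\<alpha> x" "y \<cdot> z" "\<alpha> z" "\<alpha> y"]
        assoc_skew[of "\<alpha> x" "\<alpha> z" "\<alpha> y"]
      by (simp add: twist_mult mult_minus_left)
    ultimately show ?thesis
      by (simp add: algebra_simps)
  qed
  have jordan: "assoc (\<alpha> x) ?u (\<alpha> z) \<cdot> \<alpha> ?Y = assoc ?X ?Y (\<alpha> y \<cdot> (z \<cdot> z))"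
  proof -
    have "assoc (\<alpha> x) ?u (\<alpha> z) = - assoc (\<alpha> x) (\<alpha> z) ?u"
      by (rule assoc_skew)
    also have "\<dots> = - assoc (\<alpha> x) (z \<cdot> z) (\<alpha> y)"
      by (simp only: assoc_square_middle add.commute)
    also have "\<dots> = assoc (\<alpha> x) (\<alpha> y) (z \<cdot> z)"
      by (simp only: assoc_skew[of "\<alpha> x" "\<alpha> y" "z \<cdot> z"])
    finally have "assoc (\<alpha> x) ?u (\<alpha> z) = assoc (\<alpha> x) (\<alpha> y) (z \<cdot> z)" .
    then show ?thesis
      using assoc_mult_right[of "\<alpha> x" "\<alpha> y" "z \<cdot> z"] by simp
  qed
  have "?u \<cdot> \<alpha> z = \<alpha> y \<cdot> (z \<cdot> z) + (z \<cdot> y) \<cdot> \<alpha> z"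
    using right_hom_alternative[of y z] by (simp add: hom_associator_def mult_add_left)
  then have "assoc ?X ?Y (?u \<cdot> \<alpha> z) - assoc (\<alpha> x) ?u (\<alpha> z) \<cdot> \<alpha> ?Y
      = assoc ?X ?Y ((z \<cdot> y) \<cdot> \<alpha> z)"
    by (simp add: jordan assoc_add_right)
  moreover have "assoc ?X (\<alpha> ?u) (\<alpha> (y \<cdot> z)) = - assoc ?X (\<alpha> (y \<cdot> z)) (\<alpha> (z \<cdot> y))"
    using assoc_skew[of ?X "\<alpha> (z \<cdot> y)" "\<alpha> (y \<cdot> z)"]
    by (simp add: twist_add assoc_add_middle right_hom_alternative)
  moreover have "?a \<cdot> \<alpha> (\<alpha> ?u) + assoc (\<alpha> x) ?u (\<alpha> z) \<cdot> \<alpha> ?Y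
      = assoc ?X ?Y (?u \<cdot> \<alpha> z) + assoc ?X (\<alpha> ?u) (\<alpha> (y \<cdot> z))"
    using assoc_mult_right_linearized[of "\<alpha> x" "\<alpha> y" ?u "\<alpha> z"] by (simp add: twist_mult)
  ultimately have second: "?a \<cdot> \<alpha> (\<alpha> ?u)
      = assoc ?X ?Y ((z \<cdot> y) \<cdot> \<alpha> z) - assoc ?X (\<alpha> (y \<cdot> z)) (\<alpha> (z \<cdot> y))"
    by (simp add: algebra_simps)
  have "\<alpha> (assoc x y z \<cdot> \<alpha> (z \<cdot> y)) = ?a \<cdot> \<alpha> (\<alpha> ?u) - ?a \<cdot> \<alpha> (\<alpha> (y \<cdot> z))"
    by (simp only: twist_mult[of "assoc x y z"] twist_assoc twist_add mult_add_right
        add_diff_cancel_left')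
  also have "\<dots> = - assoc ?X ?Z ((y \<cdot> z) \<cdot> \<alpha> y) - assoc ?X (\<alpha> (y \<cdot> z)) (\<alpha> (z \<cdot> y))
      - ?a \<cdot> \<alpha> (\<alpha> (y \<cdot> z))"
    by (simp only: second assoc_triple_product_skew[of x y z])
  also have "\<dots> = (assoc x y z \<cdot> ?Y) \<cdot> \<alpha> ?Z"
    by (simp only: first diff_conv_add_uminus add_ac)
  finally show ?thesis
    by (rule sym)
qed

end

theorem theorem7p1:
  fixes scale :: "'k::field_char_0 \<Rightarrow> 'a::ab_group_add \<Rightarrow> 'a"
    and mult :: "'a \<Rightarrow> 'a \<Rightarrow> 'a" (infixl "\<cdot>" 70)
    and \<alpha> :: "'a \<Rightarrow> 'a"
  assumes "multiplicative_hom_algebra scale (\<cdot>) \<alpha>"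
    and "right_hom_alternative_algebra scale (\<cdot>) \<alpha>"
  shows "\<forall>w x y z :: 'a.
    hom_associator (\<cdot>) \<alpha> (\<alpha> x) (\<alpha> y) (y \<cdot> z)
      = hom_associator (\<cdot>) \<alpha> x y z \<cdot> (\<alpha> ^^ 2) y
    \<and>
    hom_associator (\<cdot>) \<alpha> (\<alpha> x) (\<alpha> w) (y \<cdot> z) + hom_associator (\<cdot>) \<alpha> (\<alpha> x) (\<alpha> y) (w \<cdot> z)
      = hom_associator (\<cdot>) \<alpha> x w z \<cdot> (\<alpha> ^^ 2) y + hom_associator (\<cdot>) \<alpha> x y z \<cdot> (\<alpha> ^^ 2) w
    \<and>
    hom_associator (\<cdot>) \<alpha> (w \<cdot> x) (\<alpha> y) (\<alpha> z)
        + hom_associator (\<cdot>) \<alpha> (\<alpha> w) (\<alpha> x) (commutator (\<cdot>) y z)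
      = (\<alpha> ^^ 2) w \<cdot> hom_associator (\<cdot>) \<alpha> x y z + hom_associator (\<cdot>) \<alpha> w y z \<cdot> (\<alpha> ^^ 2) x
    \<and>
    hom_associator (\<cdot>) \<alpha> (\<alpha> x) (y \<cdot> y) (\<alpha> z)
      = hom_associator (\<cdot>) \<alpha> (\<alpha> x) (\<alpha> y) (y \<cdot> z + z \<cdot> y)
    \<and>
    ((x \<cdot> y) \<cdot> \<alpha> z) \<cdot> (\<alpha> ^^ 2) y = (\<alpha> ^^ 2) x \<cdot> ((y \<cdot> z) \<cdot> \<alpha> y)
    \<and>
    (hom_associator (\<cdot>) \<alpha> x y z \<cdot> (\<alpha> ^^ 2) y) \<cdot> (\<alpha> ^^ 3) z
      = \<alpha> (hom_associator (\<cdot>) \<alpha> x y z \<cdot> \<alpha> (z \<cdot> y))"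
proof -
  interpret multiplicative_right_hom_alternative_algebra scale "(\<cdot>)" \<alpha>
    using assms by (rule multiplicative_right_hom_alternative_algebra.intro)
  have twist_powers: "(\<alpha> ^^ 2) x = \<alpha> (\<alpha> x)" "(\<alpha> ^^ 3) x = \<alpha> (\<alpha> (\<alpha> x))" for x
    by (simp_all add: numeral_eq_Suc)
  show ?thesis
    unfolding twist_powers
    by (intro allI conjI assoc_mult_right assoc_mult_right_linearized assoc_mult_left
        assoc_square_middle right_hom_moufang assoc_mult_mult)
qed

end
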